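(* For every integer $d\ge 2$, the following are equivalent: (1) every compact set $K\subseteq\mathbb{R}^d$ is measure Kolmogorov; (2) every compact set $K\subseteq\mathbb{R}^d$ is distance Kolmogorov.
   Context: $\lambda$ denotes Lebesgue measure on $\mathbb{R}^d$ and $|\cdot|$ the Euclidean norm; 1-Lipschitz is with respect to the Euclidean norm. A set $P\subseteq\mathbb{R}^d$ is called a polyhedron if its topological boundary $\partial P$ can be covered by finitely many (affine) hyperplanes. A bounded measurable set $A\subseteq\mathbb{R}^d$ is called measure Kolmogorov if for every $\varepsilon>0$ there is a 1-Lipschitz map $f:A\to\mathbb{R}^d$ such that $f(A)$ is a polyhedron and $\lambda(f(A))>\lambda(A)-\varepsilon$. A bounded set $A\subseteq\mathbb{R}^d$ is called distance Kolmogorov if for every $\varepsilon>0$ there is a 1-Lipschitz map $f:A\to\mathbb{R}^d$ such that $f(A)$ is a polyhedron and $|f(x)-x|\le\varepsilon$ for every $x\in A$. *)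

theory Defs
  imports "HOL-Analysis.Analysis"
begin

definition affine_hyperplane :: "'a::euclidean_space set \<Rightarrow> bool" where
  "affine_hyperplane H \<longleftrightarrow> (\<exists>a b. a \<noteq> 0 \<and> H = {x. a \<bullet> x = b})"

text \<open>Not the library's \<^const>\<open>polyhedron\<close>, which is a finite intersection of
  closed half-spaces: here a set need be neither convex, closed nor bounded.\<close>

definition hyperplane_polyhedron :: "'a::euclidean_space set \<Rightarrow> bool" where
  "hyperplane_polyhedron P \<longleftrightarrow>
     (\<exists>\<H>. finite \<H> \<and> (\<forall>H\<in>\<H>. affine_hyperplane H) \<and> frontier P \<subseteq> \<Union>\<H>)"

text \<open>A map \<open>f : A \<rightarrow> \<real>\<^sup>d\<close> is represented by a total function of which only the values
  on \<open>A\<close> matter.\<close>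

definition measure_kolmogorov :: "'a::euclidean_space set \<Rightarrow> bool" where
  "measure_kolmogorov A \<longleftrightarrow>
     bounded A \<and> A \<in> sets lebesgue \<and>
     (\<forall>\<epsilon>>0. \<exists>f :: 'a \<Rightarrow> 'a. 1-lipschitz_on A f \<and> hyperplane_polyhedron (f ` A) \<and>
        measure lebesgue (f ` A) > measure lebesgue A - \<epsilon>)"

definition distance_kolmogorov :: "'a::euclidean_space set \<Rightarrow> bool" where
  "distance_kolmogorov A \<longleftrightarrow>
     bounded A \<and>
     (\<forall>\<epsilon>>0. \<exists>f :: 'a \<Rightarrow> 'a. 1-lipschitz_on A f \<and> hyperplane_polyhedron (f ` A) \<and>
        (\<forall>x\<in>A. norm (f x - x) \<le> \<epsilon>))"

end

theory Submission
  imports Defs "HOL-Complex_Analysis.Great_Picard"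
begin

text \<open>
  A contraction of a compact set does not increase Lebesgue measure (Vitali covering by balls).

  Distance implies measure: a contraction \<open>f\<close> of \<open>K\<close> with small displacement extends to a Lipschitz
  map \<open>F\<close> of small displacement, whose Lipschitz constant depends only on \<open>d\<close>. By Brouwer,
  \<open>K \<subseteq> F U\<close> for an open \<open>U \<supseteq> K\<close>, so \<open>K\<close> is covered by \<open>f K\<close> and the image of the small set \<open>U - K\<close>.

  Measure implies distance: surround \<open>K\<close> by a disjoint spherical shell \<open>S\<close> and take contractions of
  \<open>K \<union> S\<close> onto polyhedra with measure loss tending to \<open>0\<close>. A uniform limit \<open>g\<close> preserves measure, hence
  maps each ball in \<open>S\<close> onto a ball of the same radius, hence is an isometry on it. As \<open>S\<close> is connected
  (here \<open>d \<ge> 2\<close> enters), \<open>g\<close> is a rigid motion on \<open>S\<close>, and then also on \<open>K\<close>: a contraction that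
  fixes a sphere fixes every point inside. Undoing the rigid motion, the approximating maps move
  points of \<open>K \<union> S\<close> arbitrarily little, so the images of \<open>K\<close> and \<open>S\<close> are disjoint and the image of
  \<open>K\<close> is itself a polyhedron.
\<close>

section \<open>Measure of Lipschitz images\<close>

lemma lmeasurable_outer_open_measure:
  assumes "T \<in> lmeasurable" and "0 < e"
  obtains U where "open U" "T \<subseteq> U" "U \<in> lmeasurable" "U - T \<in> lmeasurable"
    "measure lebesgue (U - T) < e" "measure lebesgue U < measure lebesgue T + e"
proof -
  obtain U where U: "open U" "T \<subseteq> U" "U - T \<in> lmeasurable"
      "emeasure lebesgue (U - T) < ennreal e"
    using sets_lebesgue_outer_open[of T e] assms by (auto simp: fmeasurableD)
  have "U = T \<union> (U - T)"
    using U by auto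
  then have UL: "U \<in> lmeasurable"
    using U assms by (metis fmeasurable.Un)
  have small: "measure lebesgue (U - T) < e"
    using U(3,4) assms
    by (metis emeasure_eq_measure2 ennreal_less_iff measure_nonneg)
  have "measure lebesgue U = measure lebesgue T + measure lebesgue (U - T)"
    using measurable_measure_Diff[OF UL _ U(2)] assms(1) by (simp add: fmeasurableD)
  with small that U UL show thesis by auto
qed

text \<open>The part in \<open>T\<close> of a ball of radius \<open>r\<close> centred in
  \<open>T\<close> goes into a ball of radius \<open>L * r\<close>, so volumes grow at most by the
  factor \<open>L ^ DIM('a)\<close>. Vitali's theorem covers \<open>T\<close>, up to a null set, by
  disjoint balls of this kind inside an open set barely larger than \<open>T\<close>. Bounding a
  superset \<open>W\<close> keeps the measurability of the image out of the argument.\<close>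

lemma lipschitz_image_outer_measure:
  fixes f :: "'a::euclidean_space \<Rightarrow> 'a"
  assumes T: "T \<in> lmeasurable" and f: "L-lipschitz_on T f" and "0 < e"
  obtains W where "W \<in> lmeasurable" "f ` T \<subseteq> W"
    "measure lebesgue W \<le> L ^ DIM('a) * measure lebesgue T + e"
proof -
  have L: "0 \<le> L" using f lipschitz_on_nonneg by blast
  define c where "c = L ^ DIM('a)"
  have c: "0 \<le> c" using L by (simp add: c_def)
  \<comment> \<open>Dividing by \<open>c + 1\<close> instead of \<open>c\<close> allows
    \<open>c = 0\<close>; the excess contributes \<open>c * e / (c + 1) \<le> e\<close> in the
    end.\<close>
  obtain U where U: "open U" "T \<subseteq> U" "U \<in> lmeasurable"
      "measure lebesgue U < measure lebesgue T + e / (c + 1)"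
  proof (rule lmeasurable_outer_open_measure[OF T])
    show "0 < e / (c + 1)" using \<open>0 < e\<close> c by simp
  qed
  \<comment> \<open>Centres must lie in \<open>T\<close>, since \<open>f\<close> is controlled only
    there; the balls themselves may leave \<open>T\<close>.\<close>
  define I where "I = {(a, r). a \<in> T \<and> 0 < r \<and> cball a r \<subseteq> U}"
  have fine: "\<exists>i. i \<in> I \<and> x \<in> cball (fst i) (snd i) \<and> snd i < d" if "x \<in> T" "0 < d" for x d
  proof -
    obtain r where r: "0 < r" "cball x r \<subseteq> U"
      using U \<open>x \<in> T\<close> open_contains_cball by blast
    have "cball x (min r (d / 2)) \<subseteq> U"
      using r(2) subset_cball[of "min r (d / 2)" r x] by simp
    then have "(x, min r (d / 2)) \<in> I"
      using r that by (simp add: I_def)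
    then show ?thesis
      using r that by (intro exI[of _ "(x, min r (d / 2))"]) simp
  qed
  have pos: "0 < snd i" if "i \<in> I" for i
    using that by (auto simp: I_def)
  obtain D where D: "countable D" "D \<subseteq> I"
      "pairwise (\<lambda>i j. disjnt (cball (fst i) (snd i)) (cball (fst j) (snd j))) D"
      "negligible (T - (\<Union>i\<in>D. cball (fst i) (snd i)))"
    by (rule Vitali_covering_theorem_cballs[OF pos fine])
  define N where "N = T - (\<Union>i\<in>D. cball (fst i) (snd i))"
  have "negligible (f ` N)"
  proof (rule negligible_locally_Lipschitz_image[OF order_refl])
    show "negligible N" using D by (simp add: N_def)
    show "\<exists>V B. open V \<and> x \<in> V \<and> (\<forall>y\<in>N \<inter> V. norm (f y - f x) \<le> B * norm (y - x))"
      if "x \<in> N" for x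
      using lipschitz_on_normD[OF f] that by (intro exI[of _ UNIV] exI[of _ L]) (auto simp: N_def)
  qed
  define V where "V = (\<Union>i\<in>D. cball (f (fst i)) (L * snd i))"
  \<comment> \<open>The image balls may overlap, so they are only subadditive; disjointness of the
    original balls turns the sum back into the measure of a subset of \<open>U\<close>. The bound is
    uniform in \<open>J\<close> and so passes to the countable union.\<close>
  have "measure lebesgue (\<Union>i\<in>J. cball (f (fst i)) (L * snd i)) \<le> c * measure lebesgue U"
    if J: "J \<subseteq> D" "finite J" for J
  proof -
    have posJ: "0 \<le> snd i" if "i \<in> J" for i
      using that J(1) D(2) by (blast intro: less_imp_le[OF pos])
    have "measure lebesgue (\<Union>i\<in>J. cball (f (fst i)) (L * snd i))
        \<le> (\<Sum>i\<in>J. measure lebesgue (cball (f (fst i)) (L * snd i)))"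
      using J by (intro measure_UNION_le) auto
    also have "\<dots> = (\<Sum>i\<in>J. c * measure lebesgue (cball (fst i) (snd i)))"
      using posJ L by (intro sum.cong) (simp_all add: content_cball power_mult_distrib c_def)
    also have "\<dots> = c * (\<Sum>i\<in>J. measure lebesgue (cball (fst i) (snd i)))"
      by (simp add: sum_distrib_left)
    also have "(\<Sum>i\<in>J. measure lebesgue (cball (fst i) (snd i)))
        = measure lebesgue (\<Union>i\<in>J. cball (fst i) (snd i))"
      using J pairwise_subset[OF D(3) J(1)] by (intro measure_UNION'[symmetric]) auto
    also have "\<dots> \<le> measure lebesgue U"
    proof (rule measure_mono_fmeasurable[OF _ _ U(3)])
      have "cball (fst i) (snd i) \<subseteq> U" if "i \<in> I" for i
        using that by (auto simp only: I_def mem_Collect_eq case_prod_unfold)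
      then show "(\<Union>i\<in>J. cball (fst i) (snd i)) \<subseteq> U"
        using J D(2) by (intro UN_least) blast
    qed (use J in \<open>auto intro: sets.finite_UN\<close>)
    finally show ?thesis using c by (simp add: mult_left_mono)
  qed
  then have V: "V \<in> lmeasurable" "measure lebesgue V \<le> c * measure lebesgue U"
    unfolding V_def using D(1)
    by (auto intro!: fmeasurable_UN_bound[of D] measure_UN_bound[of D])
  show thesis
  proof
    show "f ` N \<union> V \<in> lmeasurable"
      using V \<open>negligible (f ` N)\<close> by (simp add: negligible_imp_measurable fmeasurable.Un)
    show "f ` T \<subseteq> f ` N \<union> V"
    proof
      fix y assume "y \<in> f ` T"
      then obtain x where x: "x \<in> T" "y = f x" by auto
      show "y \<in> f ` N \<union> V"
      proof (cases "x \<in> N")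
        case False
        then obtain i where i: "i \<in> D" "x \<in> cball (fst i) (snd i)"
          using x by (auto simp: N_def)
        then have "fst i \<in> T" using D by (auto simp: I_def)
        then have "dist (f (fst i)) (f x) \<le> L * dist (fst i) x"
          using lipschitz_onD[OF f] x by blast
        also have "\<dots> \<le> L * snd i" using i L by (auto intro: mult_left_mono)
        finally show ?thesis using i x by (auto simp: V_def)
      qed (use x in auto)
    qed
    have "measure lebesgue (f ` N \<union> V) = measure lebesgue V"
      using \<open>negligible (f ` N)\<close> V(1)
      by (metis fmeasurableD measure_Un_null_set negligible_iff_null_sets sup_commute)
    also have "\<dots> \<le> c * (measure lebesgue T + e / (c + 1))"
      using V U c by (meson less_imp_le mult_left_mono order_trans)
    also have "\<dots> \<le> c * measure lebesgue T + e"
      using c \<open>0 < e\<close> by (simp add: field_simps)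
    finally show "measure lebesgue (f ` N \<union> V) \<le> L ^ DIM('a) * measure lebesgue T + e"
      by (simp add: c_def)
  qed
qed

lemma measure_contraction_image_le:
  fixes f :: "'a::euclidean_space \<Rightarrow> 'a"
  assumes "compact T" and "1-lipschitz_on T f"
  shows "measure lebesgue (f ` T) \<le> measure lebesgue T"
proof (rule field_le_epsilon)
  fix e :: real assume "0 < e"
  obtain W where W: "W \<in> lmeasurable" "f ` T \<subseteq> W"
      "measure lebesgue W \<le> 1 ^ DIM('a) * measure lebesgue T + e"
    by (rule lipschitz_image_outer_measure
        [OF lmeasurable_compact[OF assms(1)] assms(2) \<open>0 < e\<close>])
  have "compact (f ` T)"
    using assms compact_continuous_image lipschitz_on_continuous_on by blast
  then have "measure lebesgue (f ` T) \<le> measure lebesgue W"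
    using W by (intro measure_mono_fmeasurable) (auto simp: lmeasurable_compact fmeasurableD)
  with W show "measure lebesgue (f ` T) \<le> measure lebesgue T + e" by simp
qed

section \<open>Extension of Lipschitz maps\<close>

text \<open>The McShane extension \<open>x \<mapsto> inf\<^sub>k (g k + L |x - k|)\<close>, truncated to \<open>[-e, e]\<close>.\<close>

lemma bounded_lipschitz_extension:
  fixes g :: "'a::metric_space \<Rightarrow> real"
  assumes g: "L-lipschitz_on K g" and bd: "\<And>x. x \<in> K \<Longrightarrow> \<bar>g x\<bar> \<le> e" and "0 \<le> e"
  obtains G where "L-lipschitz_on UNIV G" "\<And>x. x \<in> K \<Longrightarrow> G x = g x" "\<And>x. \<bar>G x\<bar> \<le> e"
proof (cases "K = {}")
  case True
  show thesis
    by (rule that[of "\<lambda>_. 0"])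
       (use True \<open>0 \<le> e\<close> lipschitz_on_nonneg[OF g] in \<open>auto intro!: lipschitz_onI\<close>)
next
  case False
  have L: "0 \<le> L" using g lipschitz_on_nonneg by blast
  define H where "H x = (INF k\<in>K. g k + L * dist x k)" for x
  have bdd: "bdd_below ((\<lambda>k. g k + L * dist x k) ` K)" for x
    using bd L by (intro bdd_belowI2[of _ "-e"]) (smt (verit) mult_nonneg_nonneg zero_le_dist)
  have H_le: "H x \<le> H y + L * dist x y" for x y
  proof -
    have "H x - L * dist x y \<le> g k + L * dist y k" if "k \<in> K" for k
    proof -
      have "H x \<le> g k + L * dist x k"
        unfolding H_def using bdd that by (rule cINF_lower)
      also have "\<dots> \<le> g k + L * (dist x y + dist y k)"
        using L by (intro add_left_mono mult_left_mono dist_triangle)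
      finally show ?thesis by (simp add: algebra_simps)
    qed
    then have "H x - L * dist x y \<le> H y"
      unfolding H_def[of y] using False by (intro cINF_greatest)
    then show ?thesis by simp
  qed
  have HK: "H x = g x" if "x \<in> K" for x
  proof (rule antisym)
    show "H x \<le> g x"
      using cINF_lower[OF bdd that, of x] by (simp add: H_def)
    show "g x \<le> H x"
      unfolding H_def using False
    proof (rule cINF_greatest)
      fix k assume "k \<in> K"
      then show "g x \<le> g k + L * dist x k"
        using lipschitz_onD[OF g that, of k] by (auto simp: dist_real_def)
    qed
  qed
  \<comment> \<open>Truncation is 1-Lipschitz, so it keeps the constant \<open>L\<close>.\<close>
  have clamp: "\<bar>max (- e) (min e s) - max (- e) (min e t)\<bar> \<le> \<bar>s - t\<bar>" for s t
    by linarith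
  show thesis
  proof
    show "L-lipschitz_on UNIV (\<lambda>x. max (- e) (min e (H x)))"
    proof (rule lipschitz_onI)
      show "dist (max (- e) (min e (H x))) (max (- e) (min e (H y))) \<le> L * dist x y" for x y
        using clamp[of "H x" "H y"] H_le[of x y] H_le[of y x]
        unfolding dist_real_def dist_commute[of y x] by linarith
    qed (rule L)
    show "max (- e) (min e (H x)) = g x" if "x \<in> K" for x
      using HK[OF that] bd[OF that] by linarith
    show "\<bar>max (- e) (min e (H x))\<bar> \<le> e" for x
      using \<open>0 \<le> e\<close> by linarith
  qed
qed

text \<open>The coordinates are extended one by one, and summing them costs the factor
  \<open>DIM('b)\<close> in both bounds. What counts later is that this factor does not depend on
  \<open>g\<close>.\<close>

lemma bounded_lipschitz_extension_euclidean:
  fixes g :: "'a::metric_space \<Rightarrow> 'b::euclidean_space"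
  assumes g: "L-lipschitz_on K g" and bd: "\<And>x. x \<in> K \<Longrightarrow> norm (g x) \<le> e" and "0 \<le> e"
  obtains G where "(real DIM('b) * L)-lipschitz_on UNIV G" "\<And>x. x \<in> K \<Longrightarrow> G x = g x"
    "\<And>x. norm (G x) \<le> real DIM('b) * e"
proof -
  have L: "0 \<le> L" using g lipschitz_on_nonneg by blast
  have "\<exists>G. L-lipschitz_on UNIV G \<and> (\<forall>x\<in>K. G x = g x \<bullet> i) \<and> (\<forall>x. \<bar>G x\<bar> \<le> e)"
    if i: "i \<in> Basis" for i
  proof -
    have "L-lipschitz_on K (\<lambda>x. g x \<bullet> i)"
    proof (rule lipschitz_onI)
      show "dist (g x \<bullet> i) (g y \<bullet> i) \<le> L * dist x y" if "x \<in> K" "y \<in> K" for x y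
        using lipschitz_onD[OF g that] Basis_le_norm[OF i, of "g x - g y"]
        by (simp add: dist_norm inner_diff_left)
    qed (rule L)
    moreover have "\<bar>g x \<bullet> i\<bar> \<le> e" if "x \<in> K" for x
      using Basis_le_norm[OF i, of "g x"] bd[OF that] by linarith
    ultimately show ?thesis
      by (rule bounded_lipschitz_extension[OF _ _ \<open>0 \<le> e\<close>]) blast+
  qed
  then have "\<forall>i\<in>Basis. \<exists>G. L-lipschitz_on UNIV G \<and> (\<forall>x\<in>K. G x = g x \<bullet> i) \<and> (\<forall>x. \<bar>G x\<bar> \<le> e)"
    by blast
  from bchoice[OF this] obtain G where G: "\<And>i. i \<in> Basis \<Longrightarrow> L-lipschitz_on UNIV (G i)"
      "\<And>i x. i \<in> Basis \<Longrightarrow> x \<in> K \<Longrightarrow> G i x = g x \<bullet> i"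
      "\<And>i x. i \<in> Basis \<Longrightarrow> \<bar>G i x\<bar> \<le> e"
    by blast
  define F where "F x = (\<Sum>i\<in>Basis. G i x *\<^sub>R i)" for x
  have Fi: "F x \<bullet> i = G i x" if "i \<in> Basis" for x i
    using that by (simp add: F_def)
  have lip: "(real DIM('b) * L)-lipschitz_on UNIV F"
  proof (rule lipschitz_onI)
    fix x y
    have "norm (F x - F y) \<le> (\<Sum>i\<in>Basis. \<bar>(F x - F y) \<bullet> i\<bar>)" by (rule norm_le_l1)
    also have "\<dots> \<le> (\<Sum>i\<in>(Basis::'b set). L * dist x y)"
    proof (rule sum_mono)
      fix i :: 'b assume "i \<in> Basis"
      then show "\<bar>(F x - F y) \<bullet> i\<bar> \<le> L * dist x y"
        using lipschitz_onD[OF G(1), of i x y] by (simp add: inner_diff_left Fi dist_real_def)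
    qed
    finally show "dist (F x) (F y) \<le> real DIM('b) * L * dist x y" by (simp add: dist_norm)
  next
    show "0 \<le> real DIM('b) * L" using L by simp
  qed
  have eq: "F x = g x" if "x \<in> K" for x
    by (rule euclidean_eqI) (simp only: Fi G(2)[OF _ that])
  have "norm (F x) \<le> real DIM('b) * e" for x
  proof -
    have "norm (F x) \<le> (\<Sum>i\<in>Basis. \<bar>F x \<bullet> i\<bar>)" by (rule norm_le_l1)
    also have "\<dots> \<le> (\<Sum>i\<in>(Basis::'b set). e)"
      using G(3) by (intro sum_mono) (simp only: Fi)
    finally show ?thesis by simp
  qed
  with lip eq show thesis by (rule that)
qed

section \<open>Distance Kolmogorov implies measure Kolmogorov\<close>

text \<open>A solution is a fixed point of \<open>\<lambda>x. p - G x\<close>, which maps the ball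
  of radius \<open>r\<close> about \<open>p\<close> into itself, so Brouwer's theorem
  applies.\<close>

lemma small_displacement_covers:
  fixes G :: "'a::euclidean_space \<Rightarrow> 'a"
  assumes "continuous_on UNIV G" and "\<And>x. norm (G x) \<le> r" and "0 \<le> r"
  obtains x where "x \<in> cball p r" "x + G x = p"
proof -
  obtain x where "x \<in> cball p r" "p - G x = x"
  proof (rule brouwer[of "cball p r" "\<lambda>x. p - G x"])
    show "continuous_on (cball p r) (\<lambda>x. p - G x)"
      using assms(1) by (intro continuous_intros) (auto intro: continuous_on_subset)
    show "(\<lambda>x. p - G x) \<in> cball p r \<rightarrow> cball p r"
      using assms(2) by (auto simp: dist_norm)
  qed (use assms in auto)
  then show thesis using that by (metis diff_add_cancel)
qed

lemma distance_kolmogorov_imp_measure_kolmogorov: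
  fixes K :: "'a::euclidean_space set"
  assumes K: "compact K" and dk: "distance_kolmogorov K"
  shows "measure_kolmogorov K"
  unfolding measure_kolmogorov_def
proof (intro conjI allI impI)
  show "bounded K" using K compact_imp_bounded by blast
  show "K \<in> sets lebesgue" using K by (simp add: lmeasurable_compact fmeasurableD)
  fix \<epsilon> :: real assume "0 < \<epsilon>"
  define n where "n = real DIM('a)"
  have n: "0 < n" by (simp add: n_def)
  \<comment> \<open>\<open>C\<close> bounds the growth of measure under the extended map
    \<open>F\<close>: the identity contributes 1, and the extension of the 2-Lipschitz displacement
    contributes \<open>n * 2\<close>. It is known before \<open>f\<close> is chosen, so
    \<open>U - K\<close> can be made small relative to it.\<close>
  define C where "C = (1 + n * 2) ^ DIM('a)"
  have C: "0 < C" using n by (simp add: C_def)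
  obtain U where U: "open U" "K \<subseteq> U" "U - K \<in> lmeasurable"
      "measure lebesgue (U - K) < \<epsilon> / (3 * C)"
  proof (rule lmeasurable_outer_open_measure[OF lmeasurable_compact[OF K]])
    show "0 < \<epsilon> / (3 * C)" using \<open>0 < \<epsilon>\<close> C by simp
  qed
  obtain \<rho> where \<rho>: "0 < \<rho>" "(\<Union>x\<in>K. cball x \<rho>) \<subseteq> U"
    using compact_subset_open_imp_cball_epsilon_subset[OF K U(1,2)] by blast
  \<comment> \<open>The extension multiplies the displacement bound by \<open>n\<close>, so
    \<open>\<rho> / n\<close> here leaves at most \<open>\<rho>\<close> everywhere.\<close>
  obtain f where f: "1-lipschitz_on K f" "hyperplane_polyhedron (f ` K)"
      and fx: "\<And>x. x \<in> K \<Longrightarrow> norm (f x - x) \<le> \<rho> / n"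
    using dk \<rho> n unfolding distance_kolmogorov_def by (metis divide_pos_pos)
  have "2-lipschitz_on K (\<lambda>x. f x - x)"
    using lipschitz_on_diff[OF f(1) lipschitz_on_id] by simp
  then obtain G where G: "(n * 2)-lipschitz_on UNIV G" "\<And>x. x \<in> K \<Longrightarrow> G x = f x - x"
      "\<And>x. norm (G x) \<le> n * (\<rho> / n)"
  proof (rule bounded_lipschitz_extension_euclidean[of 2 K "\<lambda>x. f x - x" "\<rho> / n"])
    show "0 \<le> \<rho> / n" using \<rho> n by simp
  qed (use fx in \<open>auto simp: n_def\<close>)
  define F where "F x = x + G x" for x
  have F: "(1 + n * 2)-lipschitz_on (U - K) F"
    unfolding F_def
    by (intro lipschitz_on_add lipschitz_on_id lipschitz_on_subset[OF G(1)]) auto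
  obtain W where W: "W \<in> lmeasurable" "F ` (U - K) \<subseteq> W"
      "measure lebesgue W \<le> C * measure lebesgue (U - K) + \<epsilon> / 3"
    using lipschitz_image_outer_measure[OF U(3) F, of "\<epsilon> / 3"] \<open>0 < \<epsilon>\<close>
    unfolding C_def by (metis divide_pos_pos zero_less_numeral)
  have fK: "compact (f ` K)"
    using K f compact_continuous_image lipschitz_on_continuous_on by blast
  \<comment> \<open>Each \<open>p\<close> in \<open>K\<close> is hit by \<open>F\<close> from a
    point within \<open>\<rho>\<close> of it, hence from \<open>U\<close>: either from
    \<open>K\<close>, where \<open>F\<close> is \<open>f\<close>, or from \<open>U - K\<close>,
    whose image lies in \<open>W\<close>.\<close>
  have "K \<subseteq> f ` K \<union> W"
  proof
    fix p assume p: "p \<in> K"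
    obtain x where x: "x \<in> cball p \<rho>" "x + G x = p"
    proof (rule small_displacement_covers[of G \<rho> p])
      show "continuous_on UNIV G" using G(1) lipschitz_on_continuous_on by blast
      show "norm (G x) \<le> \<rho>" for x using G(3)[of x] n by simp
    qed (use \<rho> in auto)
    then have "x \<in> U" using p \<rho> by blast
    moreover have "f x = p" if "x \<in> K" using x G(2)[OF that] by simp
    moreover have "F x = p" using x by (simp add: F_def)
    ultimately show "p \<in> f ` K \<union> W"
      using W(2) by (cases "x \<in> K") (auto simp: image_subset_iff)
  qed
  then have "measure lebesgue K \<le> measure lebesgue (f ` K \<union> W)"
    using K fK W by (intro measure_mono_fmeasurable)
      (auto simp: lmeasurable_compact fmeasurableD intro!: fmeasurable.Un)
  also have "\<dots> \<le> measure lebesgue (f ` K) + measure lebesgue W"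
    using fK W by (intro measure_Un_le) (auto simp: lmeasurable_compact fmeasurableD)
  also have "\<dots> < measure lebesgue (f ` K) + \<epsilon>"
  proof -
    have "C * measure lebesgue (U - K) < \<epsilon> / 3"
      using U(4) C by (simp add: field_simps)
    then show ?thesis using W(3) \<open>0 < \<epsilon>\<close> by linarith
  qed
  finally have "measure lebesgue K - \<epsilon> < measure lebesgue (f ` K)" by simp
  with f(1,2) show "\<exists>f :: 'a \<Rightarrow> 'a. 1-lipschitz_on K f \<and> hyperplane_polyhedron (f ` K) \<and>
      measure lebesgue K - \<epsilon> < measure lebesgue (f ` K)"
    by (intro exI[of _ f]) simp
qed

section \<open>Rigidity of contractions on balls\<close>

lemma norm_add_diff_unit:
  fixes w u :: "'a::real_inner"
  assumes "norm u = 1"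
  shows "(norm (w - r *\<^sub>R u))\<^sup>2 = (norm w)\<^sup>2 - 2 * r * (w \<bullet> u) + r\<^sup>2"
proof -
  have "u \<bullet> u = 1" using assms by (simp add: norm_eq_1)
  then show ?thesis
    unfolding power2_norm_eq_inner
    by (simp add: inner_diff_left inner_diff_right inner_commute power2_eq_square)
qed

text \<open>Let the diameter through \<open>x\<close> have the ends \<open>r *\<^sub>R u\<close> and
  \<open>- r *\<^sub>R u\<close>. The balls about these ends that have \<open>x\<close> on their
  boundary touch only at \<open>x\<close>, and \<open>f x\<close> lies in both.\<close>

lemma contraction_fixing_sphere_fixes_inside:
  fixes f :: "'a::euclidean_space \<Rightarrow> 'a"
  assumes f: "1-lipschitz_on X f" and X: "sphere 0 r \<subseteq> X" "x \<in> X" and x: "norm x \<le> r"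
    and fix_s: "\<And>s. s \<in> sphere 0 r \<Longrightarrow> f s = s"
  shows "f x = x"
proof (cases "norm x = r")
  case True
  then show ?thesis using fix_s by simp
next
  case False
  define t where "t = norm x"
  have t: "0 \<le> t" "t < r" using x False by (auto simp: t_def)
  obtain u where u: "norm u = 1" "x = t *\<^sub>R u"
  proof (cases "x = 0")
    case True
    obtain u :: 'a where "norm u = 1" using vector_choose_size[of 1] by auto
    then show thesis using that True by (simp add: t_def)
  next
    case False
    then show thesis
      using that[of "sgn x"] by (simp add: norm_sgn t_def sgn_div_norm)
  qed
  define p q where "p = f x \<bullet> u" and "q = (norm (f x))\<^sup>2"
  have bound: "q - 2 * c * p + c\<^sup>2 \<le> (t - c)\<^sup>2" if c: "\<bar>c\<bar> = r" for c
  proof -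
    have "c *\<^sub>R u \<in> sphere 0 r" using c u by simp
    then have "c *\<^sub>R u \<in> X" "f (c *\<^sub>R u) = c *\<^sub>R u" using X(1) fix_s by blast+
    then have "norm (f x - c *\<^sub>R u) \<le> norm (x - c *\<^sub>R u)"
      using lipschitz_on_normD[OF f X(2), of "c *\<^sub>R u"] by simp
    moreover have "norm (x - c *\<^sub>R u) = \<bar>t - c\<bar>"
      using u by (metis norm_scaleR scaleR_left_diff_distrib mult.right_neutral)
    ultimately have "(norm (f x - c *\<^sub>R u))\<^sup>2 \<le> (t - c)\<^sup>2"
      by (metis abs_ge_zero norm_ge_zero power2_abs power_mono)
    then show ?thesis
      unfolding norm_add_diff_unit[OF u(1)] p_def q_def by simp
  qed
  have 1: "q - 2 * r * p + r\<^sup>2 \<le> (t - r)\<^sup>2" and 2: "q + 2 * r * p + r\<^sup>2 \<le> (t + r)\<^sup>2"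
    using bound[of r] bound[of "- r"] t by simp_all
  have q: "q \<le> t\<^sup>2" using 1 2 by (simp add: power2_eq_square algebra_simps)
  \<comment> \<open>The bracket on the left is the squared distance from \<open>f x\<close> to
    \<open>x\<close>; multiplying the first inequality by \<open>t\<close> removes \<open>p\<close>
    from the right side.\<close>
  have "r * (q - 2 * t * p + t\<^sup>2) \<le> (r - t) * (q - t\<^sup>2)"
    using mult_left_mono[OF 1 t(1)] by (simp add: power2_eq_square algebra_simps)
  also have "\<dots> \<le> 0" using q t by (simp add: mult_nonneg_nonpos)
  finally have "q - 2 * t * p + t\<^sup>2 \<le> 0" using t by (simp add: mult_le_0_iff)
  then have "(norm (f x - t *\<^sub>R u))\<^sup>2 \<le> 0"
    unfolding norm_add_diff_unit[OF u(1)] p_def q_def .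
  then show ?thesis using u(2) by simp
qed

lemma norm_parallelogram:
  fixes a b :: "'a::real_inner"
  shows "(norm (a - b))\<^sup>2 + (norm (a + b))\<^sup>2 = 2 * (norm a)\<^sup>2 + 2 * (norm b)\<^sup>2"
  by (simp add: power2_norm_eq_inner inner_simps inner_commute)

text \<open>Antipodes have distance 2, so their images in the unit ball must be antipodal unit
  vectors. Expansion for \<open>u\<close> and \<open>- v\<close> then bounds
  \<open>z u + z v\<close> from below, and the parallelogram law turns this into an upper bound for
  \<open>z u - z v\<close>. Hence \<open>z\<close> is an isometry of the sphere, which extends to an
  orthogonal map.\<close>

lemma expanding_map_of_unit_sphere:
  fixes z :: "'a::real_inner \<Rightarrow> 'a"
  assumes z1: "\<And>u. norm u = 1 \<Longrightarrow> norm (z u) \<le> 1"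
    and z2: "\<And>u v. norm u = 1 \<Longrightarrow> norm v = 1 \<Longrightarrow> norm (u - v) \<le> norm (z u - z v)"
  obtains L where "orthogonal_transformation L" "\<And>u. norm u = 1 \<Longrightarrow> L u = z u"
proof -
  have anti: "z (- u) = - z u \<and> norm (z u) = 1" if u: "norm u = 1" for u
  proof -
    have "norm (u - (- u)) = 2" using u by (simp add: scaleR_2[symmetric])
    then have 2: "2 \<le> norm (z u - z (- u))" using z2[of u "- u"] u by simp
    then have "4 \<le> (norm (z u - z (- u)))\<^sup>2"
      using power_mono[OF 2, of 2] by simp
    moreover have "(norm (z u))\<^sup>2 \<le> 1" "(norm (z (- u)))\<^sup>2 \<le> 1"
      using z1[of u] z1[of "- u"] u by (simp_all add: power_le_one)
    ultimately have "(norm (z u + z (- u)))\<^sup>2 \<le> 0"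
      using norm_parallelogram[of "z u" "z (- u)"] by linarith
    then have eq: "z (- u) = - z u" by (simp add: eq_neg_iff_add_eq_0 add.commute)
    with 2 have "2 \<le> norm (2 *\<^sub>R z u)" by (simp add: scaleR_2)
    with z1[OF u] eq show ?thesis by simp
  qed
  have "dist (z u) (z v) = dist u v" if u: "norm u = 1" and v: "norm v = 1" for u v
  proof -
    have "norm (u + v) \<le> norm (z u + z v)"
      using z2[of u "- v"] anti[OF v] u v by simp
    then have "(norm (u + v))\<^sup>2 \<le> (norm (z u + z v))\<^sup>2" by (intro power_mono) auto
    moreover have "(norm (u - v))\<^sup>2 + (norm (u + v))\<^sup>2 = 4"
      "(norm (z u - z v))\<^sup>2 + (norm (z u + z v))\<^sup>2 = 4"
      using norm_parallelogram[of u v] norm_parallelogram[of "z u" "z v"]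
        anti[OF u] anti[OF v] u v by simp_all
    ultimately have "(norm (z u - z v))\<^sup>2 \<le> (norm (u - v))\<^sup>2" by linarith
    then have "norm (z u - z v) \<le> norm (u - v)" by (rule power2_le_imp_le) simp
    with z2[OF u v] show ?thesis by (simp add: dist_norm)
  qed
  then show thesis
    using isometry_sphere_extend[of z] anti that by metis
qed

text \<open>Choosing preimages of the boundary points of the image ball gives, after rescaling, an
  expanding map \<open>z\<close> of the unit sphere into the unit ball, which is therefore
  orthogonal. Composing \<open>f\<close> with it yields a contraction fixing the sphere, hence the
  whole ball.\<close>

lemma contraction_onto_ball_isometry:
  fixes f :: "'a::euclidean_space \<Rightarrow> 'a"
  assumes r: "0 < r" and f: "1-lipschitz_on (cball a r) f"
    and onto: "f ` cball a r = cball (f a) r"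
  obtains L where "orthogonal_transformation L" "\<And>y. y \<in> cball a r \<Longrightarrow> f y = f a + L (y - a)"
proof -
  have "\<exists>w. norm w \<le> 1 \<and> f (a + r *\<^sub>R w) = f a + r *\<^sub>R u" if u: "norm u = 1" for u
  proof -
    have "f a + r *\<^sub>R u \<in> f ` cball a r" using r u by (simp add: onto dist_norm)
    then obtain y where y: "y \<in> cball a r" "f y = f a + r *\<^sub>R u" by (metis imageE)
    then show ?thesis
      using r by (intro exI[of _ "(1 / r) *\<^sub>R (y - a)"])
        (simp add: dist_norm norm_minus_commute)
  qed
  then have "\<forall>u. \<exists>w. norm u = 1 \<longrightarrow> norm w \<le> 1 \<and> f (a + r *\<^sub>R w) = f a + r *\<^sub>R u"
    by blast
  from choice[OF this] obtain z where z: "\<And>u. norm u = 1 \<Longrightarrow> norm (z u) \<le> 1"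
      "\<And>u. norm u = 1 \<Longrightarrow> f (a + r *\<^sub>R z u) = f a + r *\<^sub>R u"
    by blast
  have in_ball: "a + r *\<^sub>R w \<in> cball a r" if "norm w \<le> 1" for w
    using that r by (simp add: dist_norm)
  have lip: "norm (f (a + r *\<^sub>R w) - f (a + r *\<^sub>R w')) \<le> r * norm (w - w')"
    if "norm w \<le> 1" "norm w' \<le> 1" for w w'
    using lipschitz_on_normD[OF f in_ball[OF that(1)] in_ball[OF that(2)]] r
    by (simp add: scaleR_diff_right[symmetric])
  have "norm (u - v) \<le> norm (z u - z v)" if u: "norm u = 1" and v: "norm v = 1" for u v
  proof -
    have "r * norm (u - v) = norm (f (a + r *\<^sub>R z u) - f (a + r *\<^sub>R z v))"
      using z(2)[OF u] z(2)[OF v] r by (simp add: scaleR_diff_right[symmetric])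
    also have "\<dots> \<le> r * norm (z u - z v)"
      using lip z(1) u v by blast
    finally show ?thesis using r by simp
  qed
  then obtain L where L: "orthogonal_transformation L" "\<And>u. norm u = 1 \<Longrightarrow> L u = z u"
    using expanding_map_of_unit_sphere[of z] z(1) by blast
  \<comment> \<open>On unit vectors \<open>L\<close> agrees with \<open>z\<close>, which picks
    preimages under the rescaled \<open>f\<close>; hence \<open>h\<close> fixes them.\<close>
  define h where "h x = (1 / r) *\<^sub>R (f (a + r *\<^sub>R L x) - f a)" for x
  have h: "h x = x" if "norm x \<le> 1" for x
  proof (rule contraction_fixing_sphere_fixes_inside[of "cball 0 1" h 1])
    show "1-lipschitz_on (cball 0 1) h"
    proof (rule lipschitz_onI)
      fix x y :: 'a assume "x \<in> cball 0 1" "y \<in> cball 0 1"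
      then have "norm (f (a + r *\<^sub>R L x) - f (a + r *\<^sub>R L y)) \<le> r * norm (L x - L y)"
        using orthogonal_transformation_norm[OF L(1)] by (intro lip) simp_all
      also have "norm (L x - L y) = norm (x - y)"
        using linear_diff[OF orthogonal_transformation_linear[OF L(1)], symmetric]
        by (simp add: orthogonal_transformation_norm[OF L(1)])
      finally have "(1 / r) * norm (f (a + r *\<^sub>R L x) - f (a + r *\<^sub>R L y))
          \<le> (1 / r) * (r * norm (x - y))"
        using r by (intro mult_left_mono) auto
      moreover have "norm (h x - h y) = (1 / r) * norm (f (a + r *\<^sub>R L x) - f (a + r *\<^sub>R L y))"
      proof -
        have "h x - h y = (1 / r) *\<^sub>R (f (a + r *\<^sub>R L x) - f (a + r *\<^sub>R L y))"
          unfolding h_def by (simp only: scaleR_diff_right[symmetric] diff_diff_eq2 diff_add_cancel)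
        then show ?thesis using r by simp
      qed
      ultimately show "dist (h x) (h y) \<le> 1 * dist x y"
        using r by (simp add: dist_norm)
    qed simp
    show "h s = s" if "s \<in> sphere 0 1" for s
      using that L(2) z(2) r by (simp add: h_def)
  qed (use that in auto)
  show thesis
  proof
    \<comment> \<open>The linear part of \<open>f\<close> is the inverse, because \<open>L\<close>
      was built from preimages.\<close>
    show "orthogonal_transformation (inv L)"
      by (rule orthogonal_transformation_inv[OF L(1)])
    show "f y = f a + inv L (y - a)" if "y \<in> cball a r" for y
    proof -
      define x where "x = (1 / r) *\<^sub>R inv L (y - a)"
      have iL: "norm (inv L w) = norm w" "L (inv L w) = w" for w
        using orthogonal_transformation_inv[OF L(1)] orthogonal_transformation_norm
          orthogonal_transformation_surj[OF L(1)] by (auto simp: surj_f_inv_f)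
      have "norm x \<le> 1"
        using that r by (simp add: x_def iL dist_norm norm_minus_commute)
      moreover have "r *\<^sub>R L x = y - a"
        using r L(1) by (simp add: x_def orthogonal_transformation_scaleR iL)
      ultimately have "(1 / r) *\<^sub>R (f y - f a) = (1 / r) *\<^sub>R inv L (y - a)"
        using h[of x] by (simp add: h_def x_def)
      then have "f y - f a = inv L (y - a)"
        using r scaleR_left_imp_eq[of "1 / r"] by fastforce
      then show ?thesis by (simp add: algebra_simps)
    qed
  qed
qed

section \<open>Measure-preserving contractions\<close>

text \<open>No part of \<open>T\<close> may lose measure, since the rest cannot gain any. So the
  image of the ball has at least the measure of the ball of radius \<open>r\<close> about
  \<open>g a\<close> that contains it; being compact, it could miss only an open part of the open
  ball, which would have positive measure.\<close>

lemma measure_preserving_contraction_onto_ball: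
  fixes g :: "'a::euclidean_space \<Rightarrow> 'a"
  assumes T: "compact T" and g: "1-lipschitz_on T g"
    and meas: "measure lebesgue T \<le> measure lebesgue (g ` T)"
    and sub: "cball a r \<subseteq> T"
  shows "g ` cball a r = cball (g a) r"
proof (cases "0 \<le> r")
  case True
  let ?B = "cball a r" and ?C = "cball (g a) r"
  have a: "a \<in> T" using sub True by auto
  have cg: "compact (g ` X)" if "compact X" "X \<subseteq> T" for X
    using that g
    by (meson compact_continuous_image continuous_on_subset lipschitz_on_continuous_on)
  have gB: "g ` ?B \<subseteq> ?C"
    using lipschitz_onD[OF g a] sub by fastforce
  \<comment> \<open>Removing the open ball keeps the rest compact; the sphere, now counted twice,
    costs nothing because open and closed balls have equal content.\<close>
  have cT: "compact (T - ball a r)" using T by (simp add: compact_diff)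
  have "T = ?B \<union> (T - ball a r)" using sub ball_subset_cball by blast
  then have "g ` T = g ` ?B \<union> g ` (T - ball a r)" by (metis image_Un)
  with meas have "measure lebesgue T \<le> measure lebesgue (g ` ?B \<union> g ` (T - ball a r))"
    by simp
  also have "\<dots> \<le> measure lebesgue (g ` ?B) + measure lebesgue (g ` (T - ball a r))"
    using cg sub cT by (intro measure_Un_le) (auto simp: lmeasurable_compact fmeasurableD)
  also have "measure lebesgue (g ` (T - ball a r)) \<le> measure lebesgue (T - ball a r)"
    using cT g lipschitz_on_subset by (intro measure_contraction_image_le) blast+
  also have "measure lebesgue (T - ball a r) = measure lebesgue T - measure lebesgue (ball a r)"
    using T sub by (intro measurable_measure_Diff)
      (auto simp: lmeasurable_compact fmeasurableD)
  also have "measure lebesgue (ball a r) = measure lebesgue ?C"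
    using True by (simp add: content_ball content_cball)
  finally have le: "measure lebesgue ?C \<le> measure lebesgue (g ` ?B)" by simp
  have "ball (g a) r \<subseteq> g ` ?B"
  proof (rule ccontr)
    define V where "V = ball (g a) r - g ` ?B"
    assume "\<not> ball (g a) r \<subseteq> g ` ?B"
    then have V: "open V" "V \<noteq> {}"
      using cg[of ?B] sub by (auto simp: V_def intro!: open_Diff compact_imp_closed)
    have VL: "V \<in> lmeasurable"
      using V by (intro lmeasurable_open) (auto simp: V_def intro: bounded_subset)
    have "measure lebesgue (g ` ?B) + measure lebesgue V = measure lebesgue (g ` ?B \<union> V)"
    proof (rule measure_Un_AE[symmetric])
      show "AE x in lebesgue. x \<notin> g ` ?B \<or> x \<notin> V" by (simp add: V_def)
    qed (use cg[of ?B] sub VL in \<open>auto simp: lmeasurable_compact\<close>)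
    also have "\<dots> \<le> measure lebesgue ?C"
      using gB VL cg[of ?B] sub by (intro measure_mono_fmeasurable)
        (auto simp: V_def lmeasurable_compact fmeasurableD)
    finally have "measure lebesgue V \<le> 0" using le by simp
    then have "negligible V"
      using VL by (simp add: negligible_iff_measure measure_le_0_iff)
    then show False using V open_not_negligible by blast
  qed
  \<comment> \<open>For \<open>r = 0\<close> the open ball is empty and its closure gives nothing,
    hence the case split.\<close>
  have "?C \<subseteq> g ` ?B"
  proof (cases "r = 0")
    case False
    with True have "?C = closure (ball (g a) r)" by simp
    also have "\<dots> \<subseteq> g ` ?B"
      using cg[of ?B] sub \<open>ball (g a) r \<subseteq> g ` ?B\<close>
      by (intro closure_minimal) (auto intro: compact_imp_closed)
    finally show ?thesis .
  qed simp
  with gB show ?thesis by blast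
qed simp

text \<open>The centre \<open>b\<close> matches the constants, and short vectors in every direction
  match the linear parts. The base points differ because each local isometry of the shell comes with
  its own.\<close>

lemma affine_eq_on_ball_imp_eq:
  fixes L L' :: "'a::real_normed_vector \<Rightarrow> 'b::real_normed_vector"
  assumes "linear L" "linear L'" and "0 < e"
    and eq: "\<And>y. y \<in> ball b e \<Longrightarrow> p + L (y - a) = q + L' (y - b)"
  shows "p + L (x - a) = q + L' (x - b)"
proof -
  interpret L: linear L by fact
  interpret L': linear L' by fact
  have pq: "p + L (b - a) = q" using eq[of b] \<open>0 < e\<close> by (simp add: L'.zero)
  have L_eq: "L w = L' w" for w
  proof -
    \<comment> \<open>This scales \<open>w\<close> into the ball; the \<open>+ 1\<close> covers
      \<open>w = 0\<close>.\<close>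
    define c where "c = e / (2 * (norm w + 1))"
    have c: "0 < c" using \<open>0 < e\<close> by (simp add: c_def add_nonneg_pos)
    have "c * norm w < c * (2 * (norm w + 1))"
      using c by (intro mult_strict_left_mono) (auto simp: add_nonneg_pos)
    also have "\<dots> = e"
    proof -
      have "0 < 2 * (norm w + 1)" by (simp add: add_nonneg_pos)
      then have "2 * (norm w + 1) \<noteq> 0" by simp
      then show ?thesis unfolding c_def by (rule nonzero_eq_divide_eq[THEN iffD1]) simp
    qed
    finally have "b + c *\<^sub>R w \<in> ball b e" using c by (simp add: dist_norm)
    from eq[OF this] have "p + L (c *\<^sub>R w + (b - a)) = q + L' (c *\<^sub>R w)"
      by (simp add: algebra_simps)
    then have "c *\<^sub>R L w = c *\<^sub>R L' w"
      using pq by (auto simp: L.add L.scaleR L'.scaleR)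
    then show ?thesis using c by simp
  qed
  have "L (x - a) = L (x - b) + L (b - a)" by (simp add: L.add[symmetric])
  then show ?thesis using pq L_eq[of "x - b"] by (simp add: algebra_simps)
qed

section \<open>Rigidity on a spherical shell\<close>

text \<open>Balls of radius \<open>R / 2\<close> about the middle sphere \<open>M\<close> fill
  \<open>S\<close>, and \<open>g\<close> is an affine isometry on each. Overlaps make neighbouring
  isometries equal, and connectedness of \<open>M\<close> makes all of them equal. Undoing the
  common isometry leaves a contraction that fixes \<open>M\<close> and hence the points of
  \<open>K\<close> inside it.\<close>

lemma contraction_rigid_on_shell:
  fixes g :: "'a::euclidean_space \<Rightarrow> 'a"
  assumes dim: "2 \<le> DIM('a)" and R: "0 < R" and K: "K \<subseteq> ball 0 R"
    and S: "S = cball 0 (3 * R) - ball 0 (2 * R)"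
    and g: "1-lipschitz_on (K \<union> S) g"
    and onto: "\<And>a r. cball a r \<subseteq> S \<Longrightarrow> g ` cball a r = cball (g a) r"
  obtains L c where "orthogonal_transformation L" "\<And>x. x \<in> K \<union> S \<Longrightarrow> L (g x) + c = x"
proof -
  define M where "M = sphere (0::'a) (5 / 2 * R)"
  have sub: "cball a (R / 2) \<subseteq> S" if "a \<in> M" for a
  proof
    fix y assume "y \<in> cball a (R / 2)"
    then have "norm (a - y) \<le> R / 2" by (simp add: dist_norm)
    moreover have "norm a = 5 / 2 * R" using that by (simp add: M_def)
    ultimately show "y \<in> S"
      using norm_triangle_ineq2[of a y] norm_triangle_ineq2[of y a] norm_minus_commute[of a y]
      by (simp add: S)
  qed
  have "\<exists>L. orthogonal_transformation L \<and> (\<forall>y\<in>cball a (R / 2). g y = g a + L (y - a))"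
    if a: "a \<in> M" for a
  proof -
    have lip: "1-lipschitz_on (cball a (R / 2)) g"
      using lipschitz_on_subset[OF g] sub[OF a] by blast
    have "0 < R / 2" using R by simp
    then obtain L where "orthogonal_transformation L"
        "\<And>y. y \<in> cball a (R / 2) \<Longrightarrow> g y = g a + L (y - a)"
      by (rule contraction_onto_ball_isometry[OF _ lip onto[OF sub[OF a]]]) blast
    then show ?thesis by blast
  qed
  then have "\<forall>a\<in>M. \<exists>L. orthogonal_transformation L \<and> (\<forall>y\<in>cball a (R / 2). g y = g a + L (y - a))"
    by blast
  from bchoice[OF this] obtain L where
    L: "\<And>a. a \<in> M \<Longrightarrow> orthogonal_transformation (L a)"
    and gL: "\<And>a y. a \<in> M \<Longrightarrow> y \<in> cball a (R / 2) \<Longrightarrow> g y = g a + L a (y - a)"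
    by blast
  define T where "T a = (\<lambda>y. g a + L a (y - a))" for a
  \<comment> \<open>With centres closer than \<open>R / 4\<close>, the ball of radius
    \<open>R / 4\<close> about \<open>b\<close> lies in both balls of radius
    \<open>R / 2\<close>.\<close>
  have T_local: "T a = T b" if a: "a \<in> M" and b: "b \<in> M" and ab: "dist a b < R / 4" for a b
  proof
    fix x
    show "T a x = T b x"
      unfolding T_def
    proof (rule affine_eq_on_ball_imp_eq[where e = "R / 4"])
      show "linear (L a)" "linear (L b)"
        using L a b orthogonal_transformation_linear by blast+
      fix y assume y: "y \<in> ball b (R / 4)"
      then have "y \<in> cball a (R / 2)" "y \<in> cball b (R / 2)"
        using ab dist_triangle[of a y b] R by auto
      then show "g a + L a (y - a) = g b + L b (y - b)"
        using gL a b by metis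
    qed (use R in simp)
  qed
  have "connected M" unfolding M_def using dim by (rule connected_sphere)
  have T_const: "T a = T b" if "a \<in> M" "b \<in> M" for a b
  proof (rule connected_local_const[OF \<open>connected M\<close> that])
    show "\<forall>a\<in>M. \<forall>\<^sub>F b in at a within M. T a = T b"
      unfolding eventually_at using T_local R
      by (metis dist_commute divide_pos_pos zero_less_numeral)
  qed
  obtain e :: 'a where e: "norm e = 5 / 2 * R"
    using vector_choose_size[of "5 / 2 * R"] R by auto
  then have e: "e \<in> M" by (simp add: M_def)
  define J where "J = inv (L e)"
  have J: "orthogonal_transformation J" "\<And>w. J (L e w) = w"
    unfolding J_def using orthogonal_transformation_inv[OF L[OF e]]
      inv_f_f[OF orthogonal_transformation_inj[OF L[OF e]]] by auto
  define h where "h x = J (g x) + (e - J (g e))" for x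
  have linJ: "J (x - y) = J x - J y" "J (x + y) = J x + J y" for x y
    using J(1) by (simp_all add: linear_diff linear_add orthogonal_transformation_linear)
  have hT: "h y = y" if "g y = T e y" for y
    using that by (simp add: h_def T_def linJ J)
  have hS: "h y = y" if y: "y \<in> S" for y
  proof -
    have ny: "2 * R \<le> norm y" "norm y \<le> 3 * R" using y by (auto simp: S)
    \<comment> \<open>The radial projection of \<open>y\<close> to \<open>M\<close>, at distance at
      most \<open>R / 2\<close> from \<open>y\<close>.\<close>
    define a where "a = (5 / 2 * R / norm y) *\<^sub>R y"
    have y0: "0 < norm y" using ny R by linarith
    have aM: "a \<in> M" using y0 R by (simp add: M_def a_def)
    have "y - a = (1 - 5 / 2 * R / norm y) *\<^sub>R y" by (simp add: a_def algebra_simps)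
    then have "norm (y - a) = \<bar>(1 - 5 / 2 * R / norm y) * norm y\<bar>"
      by (simp add: abs_mult)
    also have "(1 - 5 / 2 * R / norm y) * norm y = norm y - 5 / 2 * R"
      using y0 by (simp add: field_simps)
    finally have "norm (y - a) \<le> R / 2" using ny by linarith
    then have "y \<in> cball a (R / 2)" by (simp add: dist_norm norm_minus_commute)
    then have "g y = T a y" using gL[OF aM] by (simp add: T_def)
    then show ?thesis using T_const[OF aM e] hT by simp
  qed
  have "1-lipschitz_on (K \<union> S) h"
  proof (rule lipschitz_onI)
    fix x y assume "x \<in> K \<union> S" "y \<in> K \<union> S"
    then have "norm (g x - g y) \<le> 1 * norm (x - y)" by (rule lipschitz_on_normD[OF g])
    moreover have "h x - h y = J (g x - g y)" by (simp add: h_def linJ)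
    ultimately show "dist (h x) (h y) \<le> 1 * dist x y"
      using orthogonal_transformation_norm[OF J(1)] by (simp add: dist_norm)
  qed simp
  moreover have MS: "M \<subseteq> S" using sub R by force
  ultimately have hK: "h x = x" if "x \<in> K" for x
    using that K R hS unfolding M_def
    by (intro contraction_fixing_sphere_fixes_inside[of "K \<union> S" h "5 / 2 * R" x]) force+
  show thesis
    using that[OF J(1), of "e - J (g e)"] hS hK by (auto simp: h_def)
qed

section \<open>Limits of nearly measure-preserving contractions\<close>

text \<open>After translations that send \<open>a\<close> to 0, the maps are uniformly bounded and
  equicontinuous, so Arzela-Ascoli gives a uniform limit. Measure cannot drop in the limit: the
  images eventually lie in any open neighbourhood of the compact image of \<open>g\<close>.\<close>

lemma near_measure_preserving_limit:
  fixes f :: "nat \<Rightarrow> 'a::euclidean_space \<Rightarrow> 'a"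
  assumes T: "compact T" "a \<in> T" and f: "\<And>n. 1-lipschitz_on T (f n)"
    and meas: "\<And>n. measure lebesgue T - 1 / real (Suc n) < measure lebesgue (f n ` T)"
  obtains g and k :: "nat \<Rightarrow> nat" where "1-lipschitz_on T g" "measure lebesgue T \<le> measure lebesgue (g ` T)"
    "\<And>e. 0 < e \<Longrightarrow> \<exists>n. \<forall>x\<in>T. norm (f (k n) x - f (k n) a - g x) < e"
proof -
  define F where "F n x = f n x - f n a" for n x
  have F: "1-lipschitz_on T (F n)" for n
    using lipschitz_on_diff[OF f[of n] lipschitz_on_constant] by (simp add: F_def)
  have F_eq: "F n ` T = (+) (- f n a) ` f n ` T" for n
    by (auto simp: F_def image_image)
  obtain D where D: "\<And>x. x \<in> T \<Longrightarrow> norm (x - a) \<le> D"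
    using compact_imp_bounded[OF T(1)] bounded_any_center[of T a]
    by (auto simp: dist_norm norm_minus_commute)
  obtain g k where g: "continuous_on T g" and k: "strict_mono (k :: nat \<Rightarrow> nat)"
    and lim: "\<And>e. 0 < e \<Longrightarrow> \<exists>N. \<forall>n x. n \<ge> N \<and> x \<in> T \<longrightarrow> norm (F (k n) x - g x) < e"
  proof (rule Arzela_Ascoli[OF T(1), of F D])
    show "norm (F n x) \<le> D" if "x \<in> T" for n x
      using lipschitz_on_normD[OF f that T(2), of n] D[OF that] by (simp add: F_def)
    show "\<exists>d>0. \<forall>n y. y \<in> T \<and> norm (x - y) < d \<longrightarrow> norm (F n x - F n y) < e"
      if "x \<in> T" "0 < e" for x e
    proof (intro exI[of _ e] conjI allI impI)
      fix n y assume "y \<in> T \<and> norm (x - y) < e"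
      then show "norm (F n x - F n y) < e"
        using lipschitz_on_normD[OF F that(1), of y n] by simp
    qed (rule that(2))
  qed blast
  have g_lip: "1-lipschitz_on T g"
  proof (rule lipschitz_onI)
    fix x y assume xy: "x \<in> T" "y \<in> T"
    show "dist (g x) (g y) \<le> 1 * dist x y"
    proof (rule field_le_epsilon)
      fix e :: real assume "0 < e"
      then obtain N where N: "\<And>x. x \<in> T \<Longrightarrow> norm (F (k N) x - g x) < e / 2"
        using lim[of "e / 2"] by auto
      have "dist (g x) (g y) \<le> dist (g x) (F (k N) x) + dist (F (k N) x) (F (k N) y)
          + dist (F (k N) y) (g y)"
        by (meson add_mono dist_triangle dist_triangle_le order_refl order_trans)
      then show "dist (g x) (g y) \<le> 1 * dist x y + e"
        using N[OF xy(1)] N[OF xy(2)] lipschitz_onD[OF F xy, of "k N"]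
        by (simp add: dist_norm norm_minus_commute)
    qed
  qed simp
  have "measure lebesgue T \<le> measure lebesgue (g ` T)"
  proof (rule field_le_epsilon)
    fix e :: real assume "0 < e"
    have cg: "compact (g ` T)" using T g compact_continuous_image by blast
    obtain V where V: "open V" "g ` T \<subseteq> V" "V \<in> lmeasurable"
        "measure lebesgue V < measure lebesgue (g ` T) + e / 2"
    proof (rule lmeasurable_outer_open_measure[OF lmeasurable_compact[OF cg]])
      show "0 < e / 2" using \<open>0 < e\<close> by simp
    qed
    obtain d where d: "0 < d" "(\<Union>y\<in>g ` T. cball y d) \<subseteq> V"
      using compact_subset_open_imp_cball_epsilon_subset[OF cg V(1,2)] by blast
    obtain N where N: "\<And>n x. N \<le> n \<Longrightarrow> x \<in> T \<Longrightarrow> norm (F (k n) x - g x) < d"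
      using lim[OF d(1)] by blast
    obtain N' where N': "1 / real (Suc N') < e / 2"
      using \<open>0 < e\<close> nat_approx_posE[of "e / 2"] by auto
    \<comment> \<open>\<open>N\<close> makes the image lie in \<open>V\<close>, and
      \<open>N'\<close> makes the measure defect small; \<open>k n \<ge> n\<close> carries the
      latter over to the subsequence.\<close>
    define n where "n = max N N'"
    have "F (k n) ` T \<subseteq> V"
    proof
      fix y assume "y \<in> F (k n) ` T"
      then obtain x where x: "x \<in> T" "y = F (k n) x" by blast
      then have "y \<in> cball (g x) d"
        using N[of n x] by (simp add: n_def dist_norm norm_minus_commute)
      then show "y \<in> V" using x d(2) by blast
    qed
    moreover have "compact (F (k n) ` T)"
      using T F compact_continuous_image lipschitz_on_continuous_on by blast
    ultimately have "measure lebesgue (F (k n) ` T) \<le> measure lebesgue V"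
      using V(3) by (intro measure_mono_fmeasurable) (auto simp: lmeasurable_compact fmeasurableD)
    moreover have "measure lebesgue (F (k n) ` T) = measure lebesgue (f (k n) ` T)"
      unfolding F_eq by (rule measure_translation)
    moreover have "1 / real (Suc (k n)) \<le> 1 / real (Suc N')"
      using seq_suble[OF k, of n] by (intro divide_left_mono) (auto simp: n_def)
    ultimately show "measure lebesgue T \<le> measure lebesgue (g ` T) + e"
      using meas[of "k n"] N' V(4) by linarith
  qed
  moreover have "\<exists>n. \<forall>x\<in>T. norm (f (k n) x - f (k n) a - g x) < e" if e: "0 < e" for e
    using lim[OF e] unfolding F_def by blast
  ultimately show thesis by (intro that[OF g_lip])
qed

section \<open>Polyhedra under rigid motions and disjoint unions\<close>

text \<open>Frontiers commute with rigid motions, and a hyperplane with normal \<open>a\<close> goes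
  to one with normal \<open>L a\<close>. This lets a rigid motion be undone within the class of
  polyhedra.\<close>

lemma hyperplane_polyhedron_rigid_image:
  fixes P :: "'a::euclidean_space set"
  assumes L: "orthogonal_transformation (L :: 'a \<Rightarrow> 'a)" and P: "hyperplane_polyhedron P"
  shows "hyperplane_polyhedron ((\<lambda>x. c + L x) ` P)"
proof -
  let ?\<phi> = "\<lambda>x. c + L x"
  obtain \<H> where \<H>: "finite \<H>" "\<And>H. H \<in> \<H> \<Longrightarrow> affine_hyperplane H" "frontier P \<subseteq> \<Union>\<H>"
    using P by (auto simp: hyperplane_polyhedron_def)
  have inner: "L x \<bullet> L y = x \<bullet> y" for x y
    using L by (simp add: orthogonal_transformation_def)
  have surj: "surj L" using orthogonal_transformation_surj[OF L] .
  have "affine_hyperplane (?\<phi> ` H)" if "affine_hyperplane H" for H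
  proof -
    obtain a b where ab: "a \<noteq> 0" "H = {x. a \<bullet> x = b}"
      using \<open>affine_hyperplane H\<close> by (auto simp: affine_hyperplane_def)
    have "?\<phi> ` H = {y. L a \<bullet> y = L a \<bullet> c + b}"
    proof (intro equalityI subsetI)
      fix y assume y: "y \<in> {y. L a \<bullet> y = L a \<bullet> c + b}"
      obtain x where x: "y - c = L x" using surj by (meson surjD)
      then have y_eq: "y = c + L x" by (simp add: algebra_simps)
      with y have "x \<in> H" by (simp add: ab inner_add_right inner)
      with y_eq show "y \<in> ?\<phi> ` H" by blast
    qed (auto simp: ab inner_add_right inner)
    moreover have "L a \<noteq> 0"
      using ab(1) orthogonal_transformation_norm[OF L, of a] by auto
    ultimately show ?thesis unfolding affine_hyperplane_def by blast
  qed
  moreover have "frontier (?\<phi> ` P) = ?\<phi> ` frontier P"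
  proof -
    have lin: "linear L" and inj: "inj L"
      using L orthogonal_transformation_linear orthogonal_transformation_inj by blast+
    have "frontier (L ` P) = L ` frontier P"
      unfolding frontier_def closure_injective_linear_image[OF lin inj]
        interior_injective_linear_image[OF lin inj] image_set_diff[OF inj] ..
    then show ?thesis
      using frontier_translation[of c "L ` P"] by (simp add: image_image)
  qed
  moreover have "?\<phi> ` frontier P \<subseteq> \<Union> ((`) ?\<phi> ` \<H>)"
    using image_mono[OF \<H>(3), of ?\<phi>] by (simp add: image_Union)
  ultimately show ?thesis
    unfolding hyperplane_polyhedron_def using \<H>(1,2)
    by (intro exI[of _ "(`) ?\<phi> ` \<H>"]) auto
qed

text \<open>Points of \<open>A\<close> have a neighbourhood free of the closed set \<open>B\<close>,
  so frontier points of \<open>A\<close> stay frontier points of the union. This is how the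
  auxiliary shell is discarded.\<close>

lemma hyperplane_polyhedron_disjoint_UnD:
  assumes "closed A" "closed B" "A \<inter> B = {}" and P: "hyperplane_polyhedron (A \<union> B)"
  shows "hyperplane_polyhedron A"
proof -
  have "interior (A \<union> B) - B \<subseteq> interior A"
  proof (rule interior_maximal)
    show "interior (A \<union> B) - B \<subseteq> A" using interior_subset[of "A \<union> B"] by blast
    show "open (interior (A \<union> B) - B)" using assms(2) by (simp add: open_Diff)
  qed
  then have "A - interior A \<subseteq> A \<union> B - interior (A \<union> B)" using assms(3) by blast
  then have "frontier A \<subseteq> frontier (A \<union> B)"
    using assms(1,2) by (simp add: frontier_def closed_Un)
  with P show ?thesis unfolding hyperplane_polyhedron_def by (meson order_trans)
qed

section \<open>Measure Kolmogorov implies distance Kolmogorov\<close>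

lemma measure_kolmogorov_imp_distance_kolmogorov:
  fixes K :: "'a::euclidean_space set"
  assumes dim: "2 \<le> DIM('a)" and mk: "\<And>T :: 'a set. compact T \<Longrightarrow> measure_kolmogorov T"
    and K: "compact K"
  shows "distance_kolmogorov K"
  unfolding distance_kolmogorov_def
proof (intro conjI allI impI)
  show "bounded K" using K compact_imp_bounded by blast
  fix \<epsilon> :: real assume "0 < \<epsilon>"
  obtain R where R: "0 < R" "K \<subseteq> ball 0 R"
    using bounded_subset_ballD[OF \<open>bounded K\<close>, of 0] by blast
  define S where "S = cball (0::'a) (3 * R) - ball 0 (2 * R)"
  define T where "T = K \<union> S"
  have S: "compact S" by (simp add: S_def compact_diff)
  then have T: "compact T" using K by (simp add: T_def compact_Un)
  obtain s :: 'a where "norm s = 2 * R"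
    using vector_choose_size[of "2 * R"] R by auto
  then have s: "s \<in> T" using R by (simp add: T_def S_def)
  have "\<exists>f :: 'a \<Rightarrow> 'a. 1-lipschitz_on T f \<and> hyperplane_polyhedron (f ` T) \<and>
      measure lebesgue T - 1 / real (Suc n) < measure lebesgue (f ` T)" for n
  proof -
    have "0 < 1 / real (Suc n)" by simp
    then show ?thesis using mk[OF T] unfolding measure_kolmogorov_def by blast
  qed
  then have "\<forall>n. \<exists>f :: 'a \<Rightarrow> 'a. 1-lipschitz_on T f \<and> hyperplane_polyhedron (f ` T) \<and>
      measure lebesgue T - 1 / real (Suc n) < measure lebesgue (f ` T)" by blast
  from choice[OF this] obtain f :: "nat \<Rightarrow> 'a \<Rightarrow> 'a" where f: "\<And>n. 1-lipschitz_on T (f n)"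
      "\<And>n. hyperplane_polyhedron (f n ` T)"
      "\<And>n. measure lebesgue T - 1 / real (Suc n) < measure lebesgue (f n ` T)"
    by blast
  obtain g and k :: "nat \<Rightarrow> nat" where g: "1-lipschitz_on T g" "measure lebesgue T \<le> measure lebesgue (g ` T)"
    and lim: "\<And>e. 0 < e \<Longrightarrow> \<exists>n. \<forall>x\<in>T. norm (f (k n) x - f (k n) s - g x) < e"
    by (rule near_measure_preserving_limit[OF T s f(1,3)]) blast
  have onto: "g ` cball a r = cball (g a) r" if "cball a r \<subseteq> S" for a r
    using measure_preserving_contraction_onto_ball[OF T g] that by (simp add: T_def le_supI2)
  obtain L c where L: "orthogonal_transformation L" and Lg: "\<And>x. x \<in> T \<Longrightarrow> L (g x) + c = x"
    using contraction_rigid_on_shell[OF dim R S_def g(1)[unfolded T_def] onto]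
    unfolding T_def by blast
  \<comment> \<open>The bound \<open>\<epsilon>\<close> controls the displacement;
    \<open>R / 4\<close> keeps the images of \<open>K\<close> and \<open>S\<close> apart.\<close>
  obtain n where n: "\<And>x. x \<in> T \<Longrightarrow> norm (f (k n) x - f (k n) s - g x) < min \<epsilon> (R / 4)"
    using lim[of "min \<epsilon> (R / 4)"] \<open>0 < \<epsilon>\<close> R(1) by auto
  \<comment> \<open>With this \<open>b\<close>, \<open>\<phi> x\<close> is
    \<open>L (f (k n) x - f (k n) s) + c\<close>: the recentred map followed by the motion that
    undoes \<open>g\<close>, hence close to the identity.\<close>
  define b where "b = c - L (f (k n) s)"
  define \<phi> where "\<phi> x = b + L (f (k n) x)" for x
  have lin: "L (x - y) = L x - L y" for x y
    using L by (simp add: linear_diff orthogonal_transformation_linear)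
  have close: "norm (\<phi> x - x) < min \<epsilon> (R / 4)" if "x \<in> T" for x
  proof -
    have "\<phi> x - x = \<phi> x - (L (g x) + c)" using Lg[OF that] by simp
    also have "\<dots> = L (f (k n) x - f (k n) s - g x)"
      by (simp add: \<phi>_def b_def lin)
    finally show ?thesis using n[OF that] orthogonal_transformation_norm[OF L] by simp
  qed
  have lip: "1-lipschitz_on T \<phi>"
  proof (rule lipschitz_onI)
    fix x y assume "x \<in> T" "y \<in> T"
    then show "dist (\<phi> x) (\<phi> y) \<le> 1 * dist x y"
      using lipschitz_on_normD[OF f(1), of x y "k n"] orthogonal_transformation_norm[OF L]
      by (simp add: \<phi>_def dist_norm lin[symmetric])
  qed simp
  have compact: "compact (\<phi> ` X)" if "compact X" "X \<subseteq> T" for X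
    using that lip
    by (meson compact_continuous_image continuous_on_subset lipschitz_on_continuous_on)
  have "\<phi> ` T = (\<lambda>x. b + L x) ` f (k n) ` T"
    by (auto simp: \<phi>_def image_image)
  then have "hyperplane_polyhedron (\<phi> ` K \<union> \<phi> ` S)"
    using hyperplane_polyhedron_rigid_image[OF L f(2), of b "k n"]
    by (simp add: T_def image_Un)
  moreover have "\<phi> ` K \<inter> \<phi> ` S = {}"
  proof -
    \<comment> \<open>\<open>K\<close> and \<open>S\<close> are more than \<open>R\<close> apart,
      while the two displacements add up to less than \<open>R / 2\<close>.\<close>
    have "\<phi> x \<noteq> \<phi> y" if x: "x \<in> K" and y: "y \<in> S" for x y
    proof
      assume eq: "\<phi> x = \<phi> y"
      have "norm (\<phi> x - x) < R / 4" "norm (\<phi> x - y) < R / 4"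
        using close[of x] close[of y] x y eq by (auto simp: T_def)
      moreover have "norm x < R" "2 * R \<le> norm y"
        using x y R(2) by (auto simp: S_def)
      moreover have "norm y \<le> norm x + norm (\<phi> x - x) + norm (\<phi> x - y)"
        using norm_triangle_ineq4[of "x + (\<phi> x - x)" "\<phi> x - y"] norm_triangle_ineq[of x "\<phi> x - x"]
        by simp
      ultimately show False using R(1) by linarith
    qed
    then show ?thesis by blast
  qed
  moreover have "closed (\<phi> ` K)" "closed (\<phi> ` S)"
    using compact[of K] compact[of S] K S by (simp_all add: T_def compact_imp_closed)
  ultimately have "hyperplane_polyhedron (\<phi> ` K)"
    by (intro hyperplane_polyhedron_disjoint_UnD[of "\<phi> ` K" "\<phi> ` S"])
  moreover have "1-lipschitz_on K \<phi>" using lipschitz_on_subset[OF lip] by (simp add: T_def)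
  moreover have "norm (\<phi> x - x) \<le> \<epsilon>" if "x \<in> K" for x
    using close[of x] that by (simp add: T_def)
  ultimately show "\<exists>f :: 'a \<Rightarrow> 'a. 1-lipschitz_on K f \<and> hyperplane_polyhedron (f ` K) \<and>
      (\<forall>x\<in>K. norm (f x - x) \<le> \<epsilon>)"
    by (intro exI[of _ \<phi>]) simp
qed

theorem corollary1p8:
  assumes "2 \<le> CARD('n::finite)"
  shows "(\<forall>K :: (real ^ 'n) set. compact K \<longrightarrow> measure_kolmogorov K) \<longleftrightarrow>
         (\<forall>K :: (real ^ 'n) set. compact K \<longrightarrow> distance_kolmogorov K)"
proof -
  have "2 \<le> DIM(real ^ 'n)" using assms by simp
  then show ?thesis
    using measure_kolmogorov_imp_distance_kolmogorov[where 'a = "real ^ 'n"]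
      distance_kolmogorov_imp_measure_kolmogorov[where 'a = "real ^ 'n"]
    by (intro iffI allI impI) simp_all
qed

end
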